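(* Let $(X,d^*,f)$ be a discrete dynamical system such that $(X,d^* )$ is an ultracontinuum. Then there is no symbolic dynamical system that is topologically conjugate to $(X,d^*,f)$.
   Context: A discrete dynamical system $(X,d,f)$ consists of a set $X$, a metric $d$ on $X$, and a function $f:X\to X$ (not assumed continuous). A continuum is a compact, connected metric space with uncountably many elements. A metric space $(X,d^* )$ is an ultracontinuum if and only if there exists a metric $d$ on $X$ such that $(X,d)$ is a continuum and the metric topology of $(X,d^* )$ is strictly finer than the metric topology of $(X,d)$. A qualitative dynamical system $(Q,\ell,\sigma)$ consists of a set $Q$ of infinite (one-sided) sequences of symbols from a finite set $\Sigma$, i.e. $Q\subseteq\Sigma^{\mathbb N}$; a metric $\ell$ on $Q$ whose metric topology equals the topology on $Q$ inherited from the product topology of $\Sigma^{\mathbb N}$ ($\Sigma$ discrete); and the shift map $\sigma:Q\to Q$, which deletes the first symbol of a sequence. It is a symbolic dynamical system (subshift) if and only if, in addition, $(Q,\ell)$ is compact and $\sigma(Q)=Q$. Two discrete dynamical systems $(X_1,d_1,f_1)$ and $(X_2,d_2,f_2)$ are topologically conjugate if and only if there exists a homeomorphism $h:X_1\to X_2$ (for the metric topologies) with $h\circ f_1=f_2\circ h$. *)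

theory Defs
  imports "HOL-Analysis.Analysis"
begin

definition discrete_dynamical_system :: "'a set \<Rightarrow> ('a \<Rightarrow> 'a \<Rightarrow> real) \<Rightarrow> ('a \<Rightarrow> 'a) \<Rightarrow> bool" where
  "discrete_dynamical_system X d f \<longleftrightarrow> Metric_space X d \<and> f \<in> X \<rightarrow> X"

definition continuum :: "'a set \<Rightarrow> ('a \<Rightarrow> 'a \<Rightarrow> real) \<Rightarrow> bool" where
  "continuum X d \<longleftrightarrow>
     Metric_space X d \<and>
     compact_space (Metric_space.mtopology X d) \<and>
     connected_space (Metric_space.mtopology X d) \<and>
     uncountable X"

definition strictly_finer :: "'a topology \<Rightarrow> 'a topology \<Rightarrow> bool" where
  "strictly_finer S T \<longleftrightarrow> {U. openin T U} \<subset> {U. openin S U}"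

definition ultracontinuum :: "'a set \<Rightarrow> ('a \<Rightarrow> 'a \<Rightarrow> real) \<Rightarrow> bool" where
  "ultracontinuum X dstar \<longleftrightarrow>
     Metric_space X dstar \<and>
     (\<exists>d. continuum X d \<and>
          strictly_finer (Metric_space.mtopology X dstar) (Metric_space.mtopology X d))"

definition shift :: "(nat \<Rightarrow> 'b) \<Rightarrow> nat \<Rightarrow> 'b" where
  "shift s = (\<lambda>n. s (Suc n))"

text \<open>The third component of the system is always \<^const>\<open>shift\<close>, so only the alphabet \<open>A\<close>,
  the set \<open>Q\<close> of sequences and the metric \<open>l\<close> are parameters.\<close>

definition qualitative_dynamical_system ::
    "'b set \<Rightarrow> (nat \<Rightarrow> 'b) set \<Rightarrow> ((nat \<Rightarrow> 'b) \<Rightarrow> (nat \<Rightarrow> 'b) \<Rightarrow> real) \<Rightarrow> bool" where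
  "qualitative_dynamical_system A Q l \<longleftrightarrow>
     finite A \<and>
     Q \<subseteq> (UNIV \<rightarrow> A) \<and>
     Metric_space Q l \<and>
     Metric_space.mtopology Q l =
       subtopology (product_topology (\<lambda>_. discrete_topology A) UNIV) Q \<and>
     shift \<in> Q \<rightarrow> Q"

definition symbolic_dynamical_system ::
    "'b set \<Rightarrow> (nat \<Rightarrow> 'b) set \<Rightarrow> ((nat \<Rightarrow> 'b) \<Rightarrow> (nat \<Rightarrow> 'b) \<Rightarrow> real) \<Rightarrow> bool" where
  "symbolic_dynamical_system A Q l \<longleftrightarrow>
     qualitative_dynamical_system A Q l \<and>
     compact_space (Metric_space.mtopology Q l) \<and>
     shift ` Q = Q"

definition topologically_conjugate ::
    "'a set \<Rightarrow> ('a \<Rightarrow> 'a \<Rightarrow> real) \<Rightarrow> ('a \<Rightarrow> 'a) \<Rightarrow>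
     'b set \<Rightarrow> ('b \<Rightarrow> 'b \<Rightarrow> real) \<Rightarrow> ('b \<Rightarrow> 'b) \<Rightarrow> bool" where
  "topologically_conjugate X1 d1 f1 X2 d2 f2 \<longleftrightarrow>
     (\<exists>h. homeomorphic_map (Metric_space.mtopology X1 d1) (Metric_space.mtopology X2 d2) h \<and>
          (\<forall>x\<in>X1. h (f1 x) = f2 (h x)))"

end

theory Submission
  imports Defs
begin

text \<open>Compactness is a homeomorphism invariant, so a conjugacy carries it from the subshift
  back to \<open>dstar\<close>. Compact Hausdorff topologies are rigid: if a compact topology
  refines a Hausdorff one on the same set, the identity is a continuous bijection from compact to
  Hausdorff, hence a homeomorphism (\<open>compact_finer_than_Hausdorff_eq\<close>). So the
  refinement in an ultracontinuum could not be strict.\<close>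

text \<open>A symbolic dynamical system is compact, so a conjugacy would make the ultracontinuum compact;
  but a compact topology is never strictly finer than a Hausdorff one.\<close>

lemma compact_finer_than_Hausdorff_eq:
  assumes "compact_space S" and "Hausdorff_space T"
    and topspace: "topspace S = topspace T"
    and finer: "\<And>U. openin T U \<Longrightarrow> openin S U"
  shows "S = T"
proof -
  have "continuous_map S T id"
    using finer topspace by (metis topology_finer_continuous_id)
  \<comment> \<open>A continuous map from a compact to a Hausdorff space is closed; here the map is
    \<open>id\<close>, so the image of \<open>C\<close> is \<open>C\<close> itself.\<close>
  then have closed: "closedin T C" if "closedin S C" for C
    using continuous_imp_closed_map assms(1,2) that unfolding closed_map_def by fastforce
  \<comment> \<open>For the direction from \<open>S\<close> to \<open>T\<close>, pass to
    complements, which agree because the topspaces do.\<close>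
  have "openin S U \<longleftrightarrow> openin T U" for U
    using finer closed topspace by (metis openin_closedin_eq)
  then show ?thesis
    by (simp add: topology_eq)
qed

theorem mainTheorem2:
  fixes X :: "'a set" and dstar :: "'a \<Rightarrow> 'a \<Rightarrow> real" and f :: "'a \<Rightarrow> 'a"
  assumes "discrete_dynamical_system X dstar f"
    and "ultracontinuum X dstar"
  shows "\<not> (\<exists>(A :: 'b set) (Q :: (nat \<Rightarrow> 'b) set) (l :: (nat \<Rightarrow> 'b) \<Rightarrow> (nat \<Rightarrow> 'b) \<Rightarrow> real).
            symbolic_dynamical_system A Q l \<and>
            topologically_conjugate X dstar f Q l shift)"
proof
  assume "\<exists>(A :: 'b set) (Q :: (nat \<Rightarrow> 'b) set) (l :: (nat \<Rightarrow> 'b) \<Rightarrow> (nat \<Rightarrow> 'b) \<Rightarrow> real).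
            symbolic_dynamical_system A Q l \<and> topologically_conjugate X dstar f Q l shift"
  then obtain Q :: "(nat \<Rightarrow> 'b) set" and l h
    where "compact_space (Metric_space.mtopology Q l)"
      and "homeomorphic_map (Metric_space.mtopology X dstar) (Metric_space.mtopology Q l) h"
    unfolding symbolic_dynamical_system_def topologically_conjugate_def by blast
  then have compact: "compact_space (Metric_space.mtopology X dstar)"
    using homeomorphic_compact_space homeomorphic_map_imp_homeomorphic_space by blast
  \<comment> \<open>\<open>d\<close> is the continuum metric underlying the ultracontinuum; its
    topology is the coarse Hausdorff side of the lemma, that of \<open>dstar\<close> the fine
    compact side.\<close>
  obtain d where dstar: "Metric_space X dstar" and d: "Metric_space X d"
    and finer: "strictly_finer (Metric_space.mtopology X dstar) (Metric_space.mtopology X d)"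
    using assms(2) unfolding ultracontinuum_def continuum_def by blast
  have "Metric_space.mtopology X dstar = Metric_space.mtopology X d"
  proof (rule compact_finer_than_Hausdorff_eq[OF compact])
    show "Hausdorff_space (Metric_space.mtopology X d)"
      by (rule Metric_space.Hausdorff_space_mtopology[OF d])
    show "topspace (Metric_space.mtopology X dstar) = topspace (Metric_space.mtopology X d)"
      by (simp add: Metric_space.topspace_mtopology dstar d)
    show "openin (Metric_space.mtopology X dstar) U" if "openin (Metric_space.mtopology X d) U" for U
      using finer that unfolding strictly_finer_def by blast
  qed
  with finer show False
    unfolding strictly_finer_def by simp
qed

end
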